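(* Let $\langle G,0,+,-,\le\rangle$ be an ordered topological group where the order respects the topology, and let $T_1,T_2,\dots$ be subsets of the positive cone of $G$ that are locally cofinite at $0$. Let $n\ge 1$ and $E_n = T_1+\cdots+T_n=\{a_1+\cdots+a_n : a_i\in T_i\}$. Then any infinite subset $S$ of $E_n$ contains a strictly decreasing (infinite) sequence, i.e. there are $g_1,g_2,\dots\in S$ with $g_{m+1}<g_m$ for all $m\ge 1$.
   Context: A topological group $\langle G,0,+,-\rangle$ is a group, written additively but not assumed abelian, equipped with a Hausdorff topology for which addition and additive inverse are continuous. An ordered topological group is a topological group together with a partial order $\le$ on $G$ (not necessarily linear) such that $a\le b$ and $c\le d$ imply $a+c\le b+d$. Write $a<b$ if $a\le b$ and $a\ne b$. The order respects the topology if for every $g\in G$ the set $\{x\in G : x<g\}$ is open. The positive cone of $G$ is $\{g\in G : 0<g\}$. A subset $T\subseteq G$ is called locally cofinite at $0$ if (1) $0\notin T$, and (2) for every open neighborhood $u$ of $0$, the set $T\setminus u$ is finite. *)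

theory Defs
  imports Complex_Main
begin

(* The groups are not assumed abelian and the order need not be linear. The library
   class topological_group_add does not include the Hausdorff axiom, hence t2_space. *)
class ordered_topological_group = topological_group_add + t2_space + order +
  assumes add_mono_both: "a \<le> b \<Longrightarrow> c \<le> d \<Longrightarrow> a + c \<le> b + d"

definition order_respects_topology :: "'a::ordered_topological_group itself \<Rightarrow> bool" where
  "order_respects_topology _ \<longleftrightarrow> (\<forall>g::'a. open {x. x < g})"

definition positive_cone :: "'a::ordered_topological_group set" where
  "positive_cone = {g. 0 < g}"

definition locally_cofinite_at_0 :: "'a::{topological_space, zero} set \<Rightarrow> bool" where
  "locally_cofinite_at_0 T \<longleftrightarrow> 0 \<notin> T \<and> (\<forall>u. open u \<and> 0 \<in> u \<longrightarrow> finite (T - u))"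

(* sum_list adds a 1 + ... + a n in this order, which matters as + need not commute. *)
definition sumset :: "(nat \<Rightarrow> 'a::monoid_add set) \<Rightarrow> nat \<Rightarrow> 'a set" where
  "sumset T n = {sum_list (map a [1..<Suc n]) | a. \<forall>i\<in>{1..n}. a i \<in> T i}"

end

theory Submission
  imports Defs "HOL-Library.Infinite_Set"
begin

text \<open>All but finitely many members of a set that is locally cofinite at 0 lie in the open
  neighbourhood \<open>{x. x < t}\<close> of 0, for every positive \<open>t\<close>. Hence every sequence in such a set has a
  weakly decreasing subsequence. As in Dickson's lemma, this property passes to sums of sets, and an
  injective weakly decreasing sequence is strictly decreasing.\<close>

text \<open>Equivalently, the reversed order \<ge> is a well-quasi-order on \<open>A\<close>. The
  form with subsequences makes closure under sums direct.\<close>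

definition decreasing_subseqs :: "'a::order set \<Rightarrow> bool" where
  "decreasing_subseqs A \<longleftrightarrow>
    (\<forall>f :: nat \<Rightarrow> 'a. range f \<subseteq> A \<longrightarrow> (\<exists>r :: nat \<Rightarrow> nat. strict_mono r \<and> decseq (f \<circ> r)))"

lemma decreasing_subseqsD:
  assumes "decreasing_subseqs A" "\<And>k. f k \<in> A"
  obtains r :: "nat \<Rightarrow> nat" where "strict_mono r" "decseq (f \<circ> r)"
  using assms unfolding decreasing_subseqs_def by (metis image_subsetI)

lemma decreasing_subseqs_singleton: "decreasing_subseqs {c}"
  unfolding decreasing_subseqs_def decseq_def
  by (intro allI impI exI[of _ id]) (auto simp: strict_mono_def image_subset_iff)

text \<open>A sequence that takes some value infinitely often has a constant subsequence. Otherwise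
  every value is taken only finitely often, and each term is followed by a strictly smaller one, so
  a subsequence can be chosen step by step.\<close>

lemma decreasing_subseqs_if_cofinitely_below:
  fixes A :: "'a::order set"
  assumes "\<And>t. t \<in> A \<Longrightarrow> finite {x \<in> A. \<not> x < t}"
  shows "decreasing_subseqs A"
  unfolding decreasing_subseqs_def
proof (intro allI impI)
  fix f :: "nat \<Rightarrow> 'a"
  assume f: "range f \<subseteq> A"
  show "\<exists>r :: nat \<Rightarrow> nat. strict_mono r \<and> decseq (f \<circ> r)"
  proof (cases "\<exists>t. infinite (f -` {t})")
    case True
    then obtain t where t: "infinite (f -` {t})" by blast
    obtain r :: "nat \<Rightarrow> nat" where r: "strict_mono r" "\<And>k. r k \<in> f -` {t}"
      using infinite_enumerate[OF t] by blast
    then have "decseq (f \<circ> r)" by (simp add: decseq_def)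
    with r show ?thesis by blast
  next
    case False
    have later: "\<exists>k>m. f k < f m" for m
    proof -
      \<comment> \<open>Only finitely many values are not below \<open>f m\<close>, and each has a
        finite fibre. So only finitely many indices are bad; adding \<open>{..m}\<close> to them
        forces the new index to lie beyond \<open>m\<close>.\<close>
      have "{k. \<not> f k < f m} \<subseteq> (\<Union>t\<in>{x \<in> A. \<not> x < f m}. f -` {t})"
        using f by auto
      moreover have "finite (\<Union>t\<in>{x \<in> A. \<not> x < f m}. f -` {t})"
        using False f by (intro finite_UN_I assms) auto
      ultimately have "finite ({k. \<not> f k < f m} \<union> {..m})"
        by (simp add: finite_subset)
      then obtain k where "k \<notin> {k. \<not> f k < f m} \<union> {..m}"
        using ex_new_if_finite infinite_UNIV_nat by blast
      then show ?thesis by (auto simp: not_le)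
    qed
    obtain r where r: "\<And>m. r (Suc m) > r m \<and> f (r (Suc m)) < f (r m)"
      using dependent_nat_choice[of "\<lambda>_ _. True" "\<lambda>_ m k. k > m \<and> f k < f m"] later by blast
    then have "strict_mono r" "decseq (f \<circ> r)"
      by (auto simp: strict_mono_Suc_iff decseq_Suc_iff less_imp_le)
    then show ?thesis by blast
  qed
qed

text \<open>Two successive extractions: \<open>r\<close> makes the left summands decrease, then
  \<open>s\<close> thins \<open>r\<close> so that the right summands decrease too.\<close>

lemma decreasing_subseqs_add:
  fixes A B :: "'a::ordered_topological_group set"
  assumes "decreasing_subseqs A" "decreasing_subseqs B"
  shows "decreasing_subseqs {a + b | a b. a \<in> A \<and> b \<in> B}"
  unfolding decreasing_subseqs_def
proof (intro allI impI)
  fix f :: "nat \<Rightarrow> 'a"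
  assume "range f \<subseteq> {a + b | a b. a \<in> A \<and> b \<in> B}"
  then have "\<forall>k. \<exists>a b. f k = a + b \<and> a \<in> A \<and> b \<in> B" by blast
  then obtain a b where ab: "\<And>k. f k = a k + b k" "\<And>k. a k \<in> A" "\<And>k. b k \<in> B"
    by metis
  obtain r where r: "strict_mono r" "decseq (a \<circ> r)"
    using decreasing_subseqsD[OF assms(1) ab(2)] .
  obtain s where s: "strict_mono s" "decseq ((b \<circ> r) \<circ> s)"
    using decreasing_subseqsD[OF assms(2), of "b \<circ> r"] ab(3) by auto
  \<comment> \<open>The left summands still decrease along \<open>r \<circ> s\<close> because
    \<open>s\<close> is increasing; monotonicity of + in both arguments then combines the
    two.\<close>
  have "decseq (f \<circ> (r \<circ> s))"
    using r(2) s by (auto simp: decseq_def ab(1) strict_mono_less_eq intro!: add_mono_both)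
  moreover have "strict_mono (r \<circ> s)"
    using r(1) s(1) by (rule strict_mono_o)
  ultimately show "\<exists>r :: nat \<Rightarrow> nat. strict_mono r \<and> decseq (f \<circ> r)" by blast
qed

lemma decreasing_subseqs_mono: "decreasing_subseqs B \<Longrightarrow> A \<subseteq> B \<Longrightarrow> decreasing_subseqs A"
  unfolding decreasing_subseqs_def by blast

text \<open>Induction from the empty sum, splitting off the last summand on the right, as the order
  of summation dictates.\<close>

lemma decreasing_subseqs_sumset:
  fixes T :: "nat \<Rightarrow> 'a::ordered_topological_group set"
  assumes "\<And>i. i \<ge> 1 \<Longrightarrow> decreasing_subseqs (T i)"
  shows "decreasing_subseqs (sumset T n)"
proof (induction n)
  case 0
  have "sumset T 0 = {0}" by (simp add: sumset_def)
  then show ?case by (simp add: decreasing_subseqs_singleton)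
next
  case (Suc n)
  have "sumset T (Suc n) \<subseteq> {x + y | x y. x \<in> sumset T n \<and> y \<in> T (Suc n)}"
    unfolding sumset_def by fastforce
  moreover have "decreasing_subseqs {x + y | x y. x \<in> sumset T n \<and> y \<in> T (Suc n)}"
    using Suc assms by (intro decreasing_subseqs_add) simp_all
  ultimately show ?case
    using decreasing_subseqs_mono by blast
qed

lemma locally_cofinite_decreasing_subseqs:
  fixes A :: "'a::ordered_topological_group set"
  assumes "order_respects_topology TYPE('a)" "A \<subseteq> positive_cone" "locally_cofinite_at_0 A"
  shows "decreasing_subseqs A"
proof (rule decreasing_subseqs_if_cofinitely_below)
  fix t assume "t \<in> A"
  then have "finite (A - {x. x < t})"
    using assms
    by (auto simp: order_respects_topology_def positive_cone_def locally_cofinite_at_0_def)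
  then show "finite {x \<in> A. \<not> x < t}"
    by (simp add: set_diff_eq)
qed

theorem theorem2p5:
  fixes T :: "nat \<Rightarrow> 'a::ordered_topological_group set" and n :: nat and S :: "'a set"
  assumes "order_respects_topology TYPE('a)"
    and "\<And>i. i \<ge> 1 \<Longrightarrow> T i \<subseteq> positive_cone"
    and "\<And>i. i \<ge> 1 \<Longrightarrow> locally_cofinite_at_0 (T i)"
    and "n \<ge> 1"
    and "S \<subseteq> sumset T n"
    and "infinite S"
  shows "\<exists>g :: nat \<Rightarrow> 'a. (\<forall>m\<ge>1. g m \<in> S) \<and> (\<forall>m\<ge>1. g (m + 1) < g m)"
proof -
  have "decreasing_subseqs (sumset T n)"
    using assms(1-3) by (intro decreasing_subseqs_sumset locally_cofinite_decreasing_subseqs)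
  then have S: "decreasing_subseqs S"
    using assms(5) by (rule decreasing_subseqs_mono)
  obtain f :: "nat \<Rightarrow> 'a" where f: "inj f" "range f \<subseteq> S"
    using infinite_countable_subset[OF assms(6)] by blast
  obtain r where r: "strict_mono r" "decseq (f \<circ> r)"
    using decreasing_subseqsD[OF S, of f] f(2) by blast
  have "(f \<circ> r) (m + 1) < (f \<circ> r) m" for m
  proof -
    have "(f \<circ> r) (m + 1) \<le> (f \<circ> r) m"
      using r(2) by (simp add: decseq_Suc_iff)
    \<comment> \<open>Both \<open>f\<close> and \<open>r\<close> are injective, so consecutive terms
      differ.\<close>
    moreover have "(f \<circ> r) (m + 1) \<noteq> (f \<circ> r) m"
      using f(1) r(1) by (simp add: inj_eq strict_mono_eq)
    ultimately show ?thesis by simp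
  qed
  then show ?thesis
    \<comment> \<open>The sequence descends in \<open>S\<close> from index 0 on, hence in particular
      from index 1 on.\<close>
    using f(2) by (intro exI[of _ "f \<circ> r"]) auto
qed

end
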